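(* Let $\mathcal{L}$ be a finite-valued propositional logic and $\mathcal{I}\subseteq\mathcal{V}_\mathcal{L}$ a set of truth values, with $\mathcal{L}$ containing the unary connectives $\mathbf{I}$ and $\overline{\mathbf{I}}$ described in the context. If an $\mathsf{ME}^{\mathcal{I}}_{\mathcal{L}}$-sequent $\Sigma ; \Gamma \Rightarrow^{\mathcal{I}}_{\mathcal{L}} \Delta ; \Theta$ is provable in the calculus $\mathsf{ME}^\mathcal{I}_\mathcal{L}$, then it is true.
   Context: A finite-valued propositional logic $\mathcal{L}$ has truth values $\mathcal{V}_\mathcal{L}=\{t_1,\dots,t_n\}$ containing $\mathbf{t},\mathbf{f}$, designated values $\mathcal{V}^+_\mathcal{L}\subset\mathcal{V}_\mathcal{L}$ with $\mathbf{t}\in\mathcal{V}^+_\mathcal{L}$, $\mathbf{f}\notin\mathcal{V}^+_\mathcal{L}$, a fixed countably infinite set $\mathcal{C}$ of propositional constants, and finitely many connectives interpreted by truth functions on $\mathcal{V}_\mathcal{L}$. Interpretations are maps $I:\mathcal{C}\to\mathcal{V}_\mathcal{L}$, extended compositionally to valuations $v^I_\mathcal{L}$; $I$ is a model of $\varphi$ if $v^I_\mathcal{L}(\varphi)\in\mathcal{V}^+_\mathcal{L}$, and of a theory (set of formulas) if it models all its elements. It is assumed that $\mathcal{L}$ contains unary connectives $\mathbf{I}$ and $\overline{\mathbf{I}}$ with $v(\mathbf{I}\varphi)=\mathbf{t}$ if $v(\varphi)\in\mathcal{I}$ and $=\mathbf{f}$ otherwise, and $v(\overline{\mathbf{I}}\varphi)=\mathbf{t}$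 if $v(\varphi)\notin\mathcal{I}$ and $=\mathbf{f}$ otherwise. For $\Theta\subseteq\mathcal{C}$ write $\mathbf{I}\Theta=\{\mathbf{I}p\mid p\in\Theta\}$, $\overline{\mathbf{I}}\Theta=\{\overline{\mathbf{I}}p\mid p\in\Theta\}$. An $\mathcal{L}$-sequent is an $n$-tuple $\Gamma_1\mid\dots\mid\Gamma_n$ of finite sets of formulas, component $i$ associated with $t_i$; it is true under $I$ if some $\Gamma_i$ contains $\varphi$ with $v^I_\mathcal{L}(\varphi)=t_i$, and valid if true under every $I$. An $\mathcal{L}$-anti-sequent $\Gamma_1\nmid\dots\nmid\Gamma_n$ (finite sets) is refuted by $I$ if no $\Gamma_i$ contains $\varphi$ with $v^I_\mathcal{L}(\varphi)=t_i$, and refutable if refuted by some $I$. With $M^+=\{i\mid t_i\in\mathcal{V}^+_\mathcal{L}\}$ and $M^-=\{i\mid t_i\notin\mathcal{V}^+_\mathcal{L}\}$, $\Gamma\vdash_\mathcal{L}\Delta$ denotes the $\mathcal{L}$-sequent whose $i$-th component is $\Gamma$ for $i\in M^-$ and $\Delta$ for $i\in M^+$, and $\Gamma\dashv_\mathcal{L}\Delta$ the analogous anti-sequent. $\mathsf{S}_\mathcal{L}$ and $\mathsf{R}_\mathcal{L}$ are the sequent and anti-sequent calculi for $\mathcal{L}$ (over a vocabulary including $\mathbf{I},\overline{\mathbf{I}}$) obtained by the constructions of Zach and of Bogojeski–Tompits; they satisfy: an $\mathcal{L}$-sequent is provable in $\mathsf{S}_\mathcal{L}$ iff it is valid, and an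 $\mathcal{L}$-anti-sequent is provable in $\mathsf{R}_\mathcal{L}$ iff it is refutable. For $\Theta\subseteq\mathcal{C}$ and interpretations $I,J$: $I\le^{\mathcal{I},\Theta}_\mathcal{L}J$ iff $\{p\in\Theta\mid v^I_\mathcal{L}(p)\in\mathcal{I}\}\subseteq\{p\in\Theta\mid v^J_\mathcal{L}(p)\in\mathcal{I}\}$; $<$ is its strict part. A model $I$ of $\Gamma$ is $(\mathcal{I};\Theta)$-minimal if no model $J$ of $\Gamma$ has $J<^{\mathcal{I},\Theta}_\mathcal{L}I$. An $\mathsf{ME}^{\mathcal{I}}_{\mathcal{L}}$-sequent is a quadruple $\Sigma;\Gamma\Rightarrow^{\mathcal{I}}_{\mathcal{L}}\Delta;\Theta$ with $\Sigma,\Theta\subseteq\mathcal{C}$ and $\Gamma,\Delta$ theories; it is true if every $(\mathcal{I};\Theta\cup\Sigma)$-minimal model $I$ of $\Gamma$ with $v^I_\mathcal{L}(p)\in\mathcal{I}$ for all $p\in\Sigma$ is a model of some $\varphi\in\Delta$. The calculus $\mathsf{ME}^{\mathcal{I}}_{\mathcal{L}}$ consists of $\mathsf{S}_\mathcal{L}$, $\mathsf{R}_\mathcal{L}$, and three rules for $\mathsf{ME}$-sequents: $(m_1)$: from the anti-sequent $\Gamma,\overline{\mathbf{I}}\Theta\dashv_\mathcal{L}\mathbf{I}q$ (provable in $\mathsf{R}_\mathcal{L}$) infer $\{q\}\cup\Sigma;\Gamma\Rightarrow^{\mathcal{I}}_{\mathcal{L}}\Delta;\Theta$; $(m_2)$: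 from the sequent $\mathbf{I}\Sigma,\Gamma\vdash_\mathcal{L}\Delta$ (provable in $\mathsf{S}_\mathcal{L}$) infer $\Sigma;\Gamma\Rightarrow^{\mathcal{I}}_{\mathcal{L}}\Delta;\Theta$; $(m_3)$: from $\{q\}\cup\Sigma;\Gamma\Rightarrow^{\mathcal{I}}_{\mathcal{L}}\Delta;\Theta$ and $\Sigma;\Gamma\cup\{\overline{\mathbf{I}}q\}\Rightarrow^{\mathcal{I}}_{\mathcal{L}}\Delta;\Theta$ infer $\Sigma;\Gamma\Rightarrow^{\mathcal{I}}_{\mathcal{L}}\Delta;\Theta\cup\{q\}$. Here $q\in\mathcal{C}$, $\Sigma,\Theta\subseteq\mathcal{C}$. *)

theory Defs
  imports Main "HOL-Library.Countable" "HOL-Library.Infinite_Typeclass"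
begin

section \<open>Finite-valued propositional logics\<close>

text \<open>
  The truth values \<open>t\<^sub>1, \<dots>, t\<^sub>n\<close> are the elements of a type \<open>'v\<close> of class \<open>finite\<close>, the
  connectives the elements of a type \<open>'c\<close> of class \<open>finite\<close>, and the propositional constants
  the elements of a type \<open>'p\<close> (countably infinite in the theorems that need it). Connectives have
  arbitrary arities, so \<open>form\<close> contains ill-formed terms; the formulas of \<open>L\<close> are the
  elements of \<open>forms L\<close>.
\<close>

record ('v, 'c) fvlogic =
  ttrue :: 'v
  tfalse :: 'v
  designated :: "'v set"
  arity :: "'c \<Rightarrow> nat"
  tfun :: "'c \<Rightarrow> 'v list \<Rightarrow> 'v"

definition finite_valued_logic :: "('v::finite, 'c::finite) fvlogic \<Rightarrow> bool" where
  "finite_valued_logic L \<longleftrightarrow> ttrue L \<in> designated L \<and> tfalse L \<notin> designated L"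

datatype ('p, 'c) form = Atom 'p | Conn 'c "('p, 'c) form list"

fun wff :: "('v, 'c) fvlogic \<Rightarrow> ('p, 'c) form \<Rightarrow> bool" where
  "wff L (Atom p) \<longleftrightarrow> True"
| "wff L (Conn c \<phi>s) \<longleftrightarrow> length \<phi>s = arity L c \<and> (\<forall>\<phi> \<in> set \<phi>s. wff L \<phi>)"

definition forms :: "('v, 'c) fvlogic \<Rightarrow> ('p, 'c) form set" where
  "forms L = {\<phi>. wff L \<phi>}"

type_synonym ('p, 'v) interp = "'p \<Rightarrow> 'v"

fun val :: "('v, 'c) fvlogic \<Rightarrow> ('p, 'v) interp \<Rightarrow> ('p, 'c) form \<Rightarrow> 'v" where
  "val L I (Atom p) = I p"
| "val L I (Conn c \<phi>s) = tfun L c (map (val L I) \<phi>s)"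

definition models :: "('v, 'c) fvlogic \<Rightarrow> ('p, 'v) interp \<Rightarrow> ('p, 'c) form \<Rightarrow> bool" where
  "models L I \<phi> \<longleftrightarrow> val L I \<phi> \<in> designated L"

definition models_theory :: "('v, 'c) fvlogic \<Rightarrow> ('p, 'v) interp \<Rightarrow> ('p, 'c) form set \<Rightarrow> bool" where
  "models_theory L I \<Gamma> \<longleftrightarrow> (\<forall>\<phi> \<in> \<Gamma>. models L I \<phi>)"

text \<open>The unary connectives \<open>\<^bold>I\<close> (here \<open>i\<close>) and its overlined counterpart (here \<open>ib\<close>) for a set \<open>\<I>\<close> of truth values.\<close>

definition indicators :: "('v, 'c) fvlogic \<Rightarrow> 'v set \<Rightarrow> 'c \<Rightarrow> 'c \<Rightarrow> bool" where
  "indicators L \<I> i ib \<longleftrightarrow>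
     arity L i = 1 \<and> (\<forall>x. tfun L i [x] = (if x \<in> \<I> then ttrue L else tfalse L)) \<and>
     arity L ib = 1 \<and> (\<forall>x. tfun L ib [x] = (if x \<notin> \<I> then ttrue L else tfalse L))"

abbreviation app1 :: "'c \<Rightarrow> 'p \<Rightarrow> ('p, 'c) form" where
  "app1 c p \<equiv> Conn c [Atom p]"


section \<open>Sequents and anti-sequents\<close>

text \<open>
  The component belonging to the truth value \<open>t\<^sub>i\<close> is indexed by that value itself. Sequents and
  anti-sequents are the same tuples; they differ in their semantics.
\<close>

type_synonym ('v, 'p, 'c) tuple = "'v \<Rightarrow> ('p, 'c) form set"

definition is_sequent :: "('v, 'c) fvlogic \<Rightarrow> ('v, 'p, 'c) tuple \<Rightarrow> bool" where
  "is_sequent L S \<longleftrightarrow> (\<forall>v. finite (S v) \<and> S v \<subseteq> forms L)"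

definition seq_true :: "('v, 'c) fvlogic \<Rightarrow> ('p, 'v) interp \<Rightarrow> ('v, 'p, 'c) tuple \<Rightarrow> bool" where
  "seq_true L I S \<longleftrightarrow> (\<exists>v. \<exists>\<phi> \<in> S v. val L I \<phi> = v)"

definition valid :: "('v, 'c) fvlogic \<Rightarrow> ('v, 'p, 'c) tuple \<Rightarrow> bool" where
  "valid L S \<longleftrightarrow> (\<forall>I. seq_true L I S)"

definition refutes :: "('v, 'c) fvlogic \<Rightarrow> ('p, 'v) interp \<Rightarrow> ('v, 'p, 'c) tuple \<Rightarrow> bool" where
  "refutes L I S \<longleftrightarrow> \<not> (\<exists>v. \<exists>\<phi> \<in> S v. val L I \<phi> = v)"

definition refutable :: "('v, 'c) fvlogic \<Rightarrow> ('v, 'p, 'c) tuple \<Rightarrow> bool" where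
  "refutable L S \<longleftrightarrow> (\<exists>I. refutes L I S)"

text \<open>\<open>two_sided L \<Gamma> \<Delta>\<close> is the tuple written \<open>\<Gamma> \<turnstile> \<Delta>\<close> as a sequent and \<open>\<Gamma> \<stileturn> \<Delta>\<close> as an anti-sequent.\<close>

definition two_sided ::
  "('v, 'c) fvlogic \<Rightarrow> ('p, 'c) form set \<Rightarrow> ('p, 'c) form set \<Rightarrow> ('v, 'p, 'c) tuple" where
  "two_sided L \<Gamma> \<Delta> = (\<lambda>v. if v \<in> designated L then \<Delta> else \<Gamma>)"

definition add_at :: "'v \<Rightarrow> ('p, 'c) form \<Rightarrow> ('v, 'p, 'c) tuple \<Rightarrow> ('v, 'p, 'c) tuple" where
  "add_at v \<phi> S = S(v := insert \<phi> (S v))"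


section \<open>The calculi for sequents and anti-sequents\<close>

text \<open>
  Zach's construction takes, for every connective \<open>c\<close> and truth value \<open>v\<close>, an arbitrary
  conjunctive partial normal form of the condition ``\<open>c(A\<^sub>0, \<dots>, A\<^sub>k\<^sub>-\<^sub>1)\<close> has value \<open>v\<close>'', whose
  conjuncts are the premises of the introduction rule of \<open>c\<close> at place \<open>v\<close>. A conjunct \<open>D\<close> is a
  schematic sequent: \<open>j \<in> D w\<close> means that the component of \<open>w\<close> contains \<open>A\<^sub>j\<close>. Such normal forms
  are not unique, so the calculi depend on the family \<open>P\<close> of chosen forms.
\<close>

type_synonym ('v, 'c) pnf = "'c \<Rightarrow> 'v \<Rightarrow> ('v \<Rightarrow> nat set) set"

definition partial_normal_forms :: "('v, 'c) fvlogic \<Rightarrow> ('v, 'c) pnf \<Rightarrow> bool" where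
  "partial_normal_forms L P \<longleftrightarrow>
     (\<forall>c v. (\<forall>D \<in> P c v. \<forall>w. D w \<subseteq> {..<arity L c}) \<and>
            (\<forall>xs. length xs = arity L c \<longrightarrow>
               (tfun L c xs = v \<longleftrightarrow> (\<forall>D \<in> P c v. \<exists>w. \<exists>j \<in> D w. xs ! j = w))))"

definition premise ::
  "('v \<Rightarrow> nat set) \<Rightarrow> ('p, 'c) form list \<Rightarrow> ('v, 'p, 'c) tuple \<Rightarrow> ('v, 'p, 'c) tuple" where
  "premise D \<phi>s S = (\<lambda>w. S w \<union> (\<lambda>j. \<phi>s ! j) ` D w)"

text \<open>Exchange and contraction are implicit, since components are sets.\<close>

inductive S_provable :: "('v, 'c) fvlogic \<Rightarrow> ('v, 'c) pnf \<Rightarrow> ('v, 'p, 'c) tuple \<Rightarrow> bool"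
  for L P where
  ax: "\<phi> \<in> forms L \<Longrightarrow> S_provable L P (\<lambda>_. {\<phi>})"
| weak: "S_provable L P S \<Longrightarrow> \<phi> \<in> forms L \<Longrightarrow> S_provable L P (add_at v \<phi> S)"
| intro: "is_sequent L S \<Longrightarrow> Conn c \<phi>s \<in> forms L \<Longrightarrow>
    (\<And>D. D \<in> P c v \<Longrightarrow> S_provable L P (premise D \<phi>s S)) \<Longrightarrow>
    S_provable L P (add_at v (Conn c \<phi>s) S)"
| cut: "S_provable L P (add_at v \<phi> S) \<Longrightarrow> S_provable L P (add_at w \<phi> T) \<Longrightarrow> v \<noteq> w \<Longrightarrow>
    S_provable L P (\<lambda>u. S u \<union> T u)"

text \<open>
  Anti-sequents (Bogojeski and Tompits): the axioms consist of propositional constants none of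
  which occurs in all components, and each premise of a rule of Zach's calculus yields a unary rule.
\<close>

inductive R_provable :: "('v, 'c) fvlogic \<Rightarrow> ('v, 'c) pnf \<Rightarrow> ('v, 'p, 'c) tuple \<Rightarrow> bool"
  for L P where
  ax: "is_sequent L S \<Longrightarrow> (\<And>v. S v \<subseteq> range Atom) \<Longrightarrow> (\<Inter>v. S v) = {} \<Longrightarrow> R_provable L P S"
| intro: "is_sequent L S \<Longrightarrow> Conn c \<phi>s \<in> forms L \<Longrightarrow> D \<in> P c v \<Longrightarrow>
    R_provable L P (premise D \<phi>s S) \<Longrightarrow> R_provable L P (add_at v (Conn c \<phi>s) S)"


subsection \<open>Existence of partial normal forms\<close>

lemma partial_normal_forms_exist:
  fixes L :: "('v, 'c) fvlogic"
  shows "\<exists>P. partial_normal_forms L P"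
proof -
  define P :: "('v, 'c) pnf" where
    "P = (\<lambda>c v. {D. \<exists>ys. length ys = arity L c \<and> tfun L c ys \<noteq> v \<and>
                        D = (\<lambda>w. {j. j < arity L c \<and> ys ! j \<noteq> w})})"
  have "tfun L c xs = v \<longleftrightarrow> (\<forall>D \<in> P c v. \<exists>w. \<exists>j \<in> D w. xs ! j = w)"
    if "length xs = arity L c" for c v xs
  proof
    assume "tfun L c xs = v"
    then have "\<exists>j < arity L c. ys ! j \<noteq> xs ! j"
      if "length ys = arity L c" "tfun L c ys \<noteq> v" for ys
      using that \<open>length xs = arity L c\<close> by (metis nth_equalityI)
    then show "\<forall>D \<in> P c v. \<exists>w. \<exists>j \<in> D w. xs ! j = w"
      unfolding P_def by fastforce
  next
    assume *: "\<forall>D \<in> P c v. \<exists>w. \<exists>j \<in> D w. xs ! j = w"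
    show "tfun L c xs = v"
    proof (rule ccontr)
      assume "tfun L c xs \<noteq> v"
      then have "(\<lambda>w. {j. j < arity L c \<and> xs ! j \<noteq> w}) \<in> P c v"
        using that unfolding P_def by blast
      from bspec[OF * this] show False by simp
    qed
  qed
  moreover have "\<forall>D \<in> P c v. \<forall>w. D w \<subseteq> {..<arity L c}" for c v
    unfolding P_def by auto
  ultimately have "partial_normal_forms L P"
    unfolding partial_normal_forms_def by simp
  then show ?thesis by (rule exI[of _ P])
qed


subsection \<open>Adequacy of the calculi\<close>

lemma is_sequent_add_at [simp]:
  "is_sequent L (add_at v \<phi> S) \<longleftrightarrow> is_sequent L S \<and> \<phi> \<in> forms L"
  unfolding is_sequent_def add_at_def by (auto split: if_splits)

lemma is_sequent_premise:
  assumes "partial_normal_forms L P" "is_sequent L S" "Conn c \<phi>s \<in> forms L" "D \<in> P c v"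
  shows "is_sequent L (premise D \<phi>s S)"
proof -
  have D: "D w \<subseteq> {..<length \<phi>s}" for w
    using assms by (auto simp: partial_normal_forms_def forms_def)
  then have "finite (D w)" for w by (meson finite_lessThan finite_subset)
  moreover have "\<phi>s ! j \<in> forms L" if "j \<in> D w" for j w
  proof -
    have "j < length \<phi>s" using D that by auto
    then show ?thesis using assms(3) by (auto simp: forms_def)
  qed
  ultimately show ?thesis
    using assms(2) by (auto simp: is_sequent_def premise_def)
qed

lemma seq_true_add_at: "seq_true L I (add_at v \<phi> S) \<longleftrightarrow> val L I \<phi> = v \<or> seq_true L I S"
  unfolding seq_true_def add_at_def by (auto split: if_splits)

lemma refutes_iff: "refutes L I S \<longleftrightarrow> \<not> seq_true L I S"
  unfolding refutes_def seq_true_def ..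

lemma seq_true_intro:
  assumes P: "partial_normal_forms L P" and c: "Conn c \<phi>s \<in> forms L"
  shows "seq_true L I (add_at v (Conn c \<phi>s) S) \<longleftrightarrow> (\<forall>D \<in> P c v. seq_true L I (premise D \<phi>s S))"
proof -
  have len: "length \<phi>s = arity L c" using c by (simp add: forms_def)
  have D: "j < length \<phi>s" if "D \<in> P c v" "j \<in> D w" for D j w
    using that P len unfolding partial_normal_forms_def by fastforce
  have "val L I (Conn c \<phi>s) = v \<longleftrightarrow> (\<forall>D \<in> P c v. \<exists>w. \<exists>j \<in> D w. map (val L I) \<phi>s ! j = w)"
    using P len unfolding partial_normal_forms_def by simp
  also have "\<dots> \<longleftrightarrow> (\<forall>D \<in> P c v. \<exists>w. \<exists>j \<in> D w. val L I (\<phi>s ! j) = w)"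
    using D by (intro ball_cong bex_cong ex_cong1 refl) simp
  finally have "val L I (Conn c \<phi>s) = v \<longleftrightarrow> (\<forall>D \<in> P c v. \<exists>w. \<exists>j \<in> D w. val L I (\<phi>s ! j) = w)" .
  moreover have "seq_true L I (premise D \<phi>s S) \<longleftrightarrow>
      (\<exists>w. \<exists>j \<in> D w. val L I (\<phi>s ! j) = w) \<or> seq_true L I S" for D
    unfolding seq_true_def premise_def by (simp add: bex_Un ex_disj_distrib disj_commute)
  ultimately show ?thesis
    unfolding seq_true_add_at by simp
qed

lemma S_provable_is_sequent: "S_provable L P S \<Longrightarrow> is_sequent L S"
proof (induction rule: S_provable.induct)
  case (ax \<phi>)
  then show ?case by (simp add: is_sequent_def)
next
  case (cut v \<phi> S w T)
  then have "is_sequent L S" "is_sequent L T" by simp_all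
  then show ?case by (simp add: is_sequent_def)
qed simp_all

lemma R_provable_is_sequent: "R_provable L P S \<Longrightarrow> is_sequent L S"
  by (induction rule: R_provable.induct) simp_all

lemma S_sound:
  assumes "partial_normal_forms L P" "S_provable L P S"
  shows "seq_true L I S"
  using assms(2)
proof (induction rule: S_provable.induct)
  case (ax \<phi>)
  then show ?case by (simp add: seq_true_def)
next
  case (weak S \<phi> v)
  then show ?case by (simp add: seq_true_add_at)
next
  case (intro S c \<phi>s v)
  then show ?case by (simp add: seq_true_intro[OF assms(1)])
next
  case (cut v \<phi> S w T)
  then have "seq_true L I S \<or> seq_true L I T" by (auto simp: seq_true_add_at)
  then show ?case by (auto simp: seq_true_def)
qed

lemma R_sound:
  assumes "partial_normal_forms L P" "R_provable L P S"
  shows "\<exists>I. refutes L I S"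
  using assms(2)
proof (induction rule: R_provable.induct)
  case (ax S)
  then have "\<exists>v. Atom p \<notin> S v" for p by blast
  then obtain I where I: "Atom p \<notin> S (I p)" for p by metis
  have "\<not> seq_true L I S"
  proof
    assume "seq_true L I S"
    then obtain \<phi> where \<phi>: "\<phi> \<in> S (val L I \<phi>)" unfolding seq_true_def by auto
    moreover obtain p where "\<phi> = Atom p" using ax(2) \<phi> by blast
    ultimately show False using I[of p] by simp
  qed
  then show ?case by (auto simp: refutes_iff)
next
  case (intro S c \<phi>s D v)
  then show ?case using seq_true_intro[OF assms(1)] by (metis refutes_iff)
qed

primrec weight :: "nat \<Rightarrow> ('p, 'c) form \<Rightarrow> nat" where
  "weight N (Atom p) = 0"
| "weight N (Conn c \<phi>s) = Suc (N * sum_list (map (weight N) \<phi>s))"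

definition seq_weight :: "('v::finite, 'p, 'c) tuple \<Rightarrow> nat" where
  "seq_weight S = (\<Sum>v\<in>UNIV. \<Sum>\<phi>\<in>S v. weight (card (UNIV :: 'v set)) \<phi>)"

lemma seq_weight_add_at:
  fixes S :: "('v::finite, 'p, 'c) tuple"
  assumes "finite (S v)" "\<phi> \<notin> S v"
  shows "seq_weight (add_at v \<phi> S) = weight (card (UNIV :: 'v set)) \<phi> + seq_weight S"
proof -
  let ?w = "weight (card (UNIV :: 'v set))"
  have "(\<Sum>u\<in>UNIV - {v}. sum ?w (add_at v \<phi> S u)) = (\<Sum>u\<in>UNIV - {v}. sum ?w (S u))"
    by (rule sum.cong) (auto simp: add_at_def)
  moreover have "sum ?w (add_at v \<phi> S v) = ?w \<phi> + sum ?w (S v)"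
    using assms by (simp add: add_at_def)
  ultimately show ?thesis
    unfolding seq_weight_def by (simp add: sum.remove[of UNIV v])
qed

lemma seq_weight_premise:
  fixes S :: "('v::finite, 'p, 'c) tuple"
  assumes P: "partial_normal_forms L P" and S: "is_sequent L S"
    and c: "Conn c \<phi>s \<in> forms L" and D: "D \<in> P c v"
  shows "seq_weight (premise D \<phi>s S) < weight (card (UNIV :: 'v set)) (Conn c \<phi>s) + seq_weight S"
proof -
  let ?w = "weight (card (UNIV :: 'v set)) :: ('p, 'c) form \<Rightarrow> nat"
  have sub: "D w \<subseteq> {..<length \<phi>s}" for w
    using P c D by (auto simp: partial_normal_forms_def forms_def)
  then have fin: "finite (D w)" for w by (meson finite_lessThan finite_subset)
  have "sum ?w (premise D \<phi>s S u) \<le> sum ?w (S u) + sum_list (map ?w \<phi>s)" for u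
  proof -
    have "sum ?w (premise D \<phi>s S u) \<le> sum ?w (S u) + sum ?w ((\<lambda>j. \<phi>s ! j) ` D u)"
      unfolding premise_def using S fin
      by (subst sum_Un_nat) (auto simp: is_sequent_def)
    also have "sum ?w ((\<lambda>j. \<phi>s ! j) ` D u) \<le> (\<Sum>j\<in>D u. ?w (\<phi>s ! j))"
      by (rule sum_image_le[OF fin, unfolded o_def]) simp
    also have "\<dots> \<le> (\<Sum>j<length \<phi>s. ?w (\<phi>s ! j))"
      by (rule sum_mono2) (use sub in auto)
    also have "\<dots> = sum_list (map ?w \<phi>s)"
      by (simp add: sum_list_sum_nth atLeast0LessThan)
    finally show ?thesis by simp
  qed
  then have "seq_weight (premise D \<phi>s S) \<le> (\<Sum>u\<in>UNIV. sum ?w (S u) + sum_list (map ?w \<phi>s))"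
    unfolding seq_weight_def by (intro sum_mono) simp
  also have "\<dots> = seq_weight S + card (UNIV :: 'v set) * sum_list (map ?w \<phi>s)"
    by (simp add: seq_weight_def sum.distrib)
  finally show ?thesis by simp
qed

lemma sequent_induct [consumes 2, case_names atomic compound]:
  fixes S :: "('v::finite, 'p, 'c) tuple"
  assumes P: "partial_normal_forms L P" and S: "is_sequent L S"
    and atomic: "\<And>S. is_sequent L S \<Longrightarrow> (\<And>v. S v \<subseteq> range Atom) \<Longrightarrow> Q S"
    and compound: "\<And>S c \<phi>s v. is_sequent L S \<Longrightarrow> Conn c \<phi>s \<in> forms L \<Longrightarrow>
           (\<And>D. D \<in> P c v \<Longrightarrow> Q (premise D \<phi>s S)) \<Longrightarrow> Q (add_at v (Conn c \<phi>s) S)"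
  shows "Q S"
  using S
proof (induction "seq_weight S" arbitrary: S rule: less_induct)
  case less
  show ?case
  proof (cases "\<forall>v. S v \<subseteq> range Atom")
    case True
    then show ?thesis using atomic less.prems by blast
  next
    case False
    then obtain v \<psi> where "\<psi> \<in> S v" "\<psi> \<notin> range Atom" by blast
    then obtain c \<phi>s where c: "Conn c \<phi>s \<in> S v" by (cases \<psi>) auto
    define T where "T = S(v := S v - {Conn c \<phi>s})"
    have ST: "S = add_at v (Conn c \<phi>s) T"
      unfolding T_def add_at_def using c by (auto simp: fun_eq_iff)
    have T: "is_sequent L T" "Conn c \<phi>s \<in> forms L" using less.prems ST by auto
    have "finite (T v)" "Conn c \<phi>s \<notin> T v"
      using T(1) unfolding is_sequent_def by (blast, simp add: T_def)
    then have w: "seq_weight S = weight (card (UNIV :: 'v set)) (Conn c \<phi>s) + seq_weight T"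
      unfolding ST by (rule seq_weight_add_at)
    show ?thesis unfolding ST
    proof (rule compound[OF T])
      fix D assume D: "D \<in> P c v"
      show "Q (premise D \<phi>s T)"
        using seq_weight_premise[OF P T D] is_sequent_premise[OF P T D] w
        by (intro less.hyps) auto
    qed
  qed
qed

lemma S_weaken:
  fixes S :: "('v::finite, 'p, 'c) tuple"
  assumes "S_provable L P S" "is_sequent L T"
  shows "S_provable L P (\<lambda>v. S v \<union> T v)"
proof -
  have one: "S_provable L P (\<lambda>u. if u = v then S u \<union> A else S u)"
    if "S_provable L P S" "finite A" "A \<subseteq> forms L" for A v and S :: "('v, 'p, 'c) tuple"
    using that(2,3)
  proof (induction A rule: finite_induct)
    case empty
    have "(\<lambda>u. if u = v then S u \<union> {} else S u) = S" by (simp add: fun_eq_iff)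
    then show ?case using that(1) by simp
  next
    case (insert \<phi> A)
    then have "S_provable L P (add_at v \<phi> (\<lambda>u. if u = v then S u \<union> A else S u))"
      by (intro S_provable.weak) auto
    also have "add_at v \<phi> (\<lambda>u. if u = v then S u \<union> A else S u)
             = (\<lambda>u. if u = v then S u \<union> insert \<phi> A else S u)"
      by (simp add: add_at_def fun_eq_iff)
    finally show ?case .
  qed
  have "S_provable L P (\<lambda>u. if u \<in> V then S u \<union> T u else S u)" if "finite V" for V
    using that
  proof (induction V rule: finite_induct)
    case empty
    then show ?case using assms(1) by simp
  next
    case (insert v V)
    have "S_provable L P (\<lambda>u. if u = v
        then (if u \<in> V then S u \<union> T u else S u) \<union> T v
        else (if u \<in> V then S u \<union> T u else S u))"
      by (rule one[OF insert.IH]) (use assms(2) in \<open>auto simp: is_sequent_def\<close>)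
    also have "(\<lambda>u. if u = v
        then (if u \<in> V then S u \<union> T u else S u) \<union> T v
        else (if u \<in> V then S u \<union> T u else S u))
        = (\<lambda>u. if u \<in> insert v V then S u \<union> T u else S u)"
      by (auto simp: fun_eq_iff)
    finally show ?case .
  qed
  from this[of UNIV] show ?thesis by simp
qed

lemma S_complete:
  fixes S :: "('v::finite, 'p, 'c) tuple"
  assumes P: "partial_normal_forms L P" and S: "is_sequent L S" and "valid L S"
  shows "S_provable L P S"
  using P S assms(3)
proof (induction rule: sequent_induct)
  case (atomic S)
  show ?case
  proof (cases "(\<Inter>v. S v) = {}")
    case True
    then have "R_provable L P S" by (rule R_provable.ax[OF atomic(1,2)])
    then show ?thesis
      using R_sound[OF P] atomic(3) by (auto simp: refutes_iff valid_def)
  next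
    case False
    then obtain \<phi> where \<phi>: "\<phi> \<in> S v" for v by auto
    then have "S_provable L P (\<lambda>_. {\<phi>})"
      using atomic(1) by (intro S_provable.ax) (auto simp: is_sequent_def)
    from S_weaken[OF this atomic(1)] show ?thesis
      using \<phi> by (simp add: insert_absorb)
  qed
next
  case (compound S c \<phi>s v)
  then show ?case
    by (intro S_provable.intro) (auto simp: valid_def seq_true_intro[OF P])
qed

lemma R_complete:
  fixes S :: "('v::finite, 'p, 'c) tuple"
  assumes P: "partial_normal_forms L P" and S: "is_sequent L S" and "refutes L I S"
  shows "R_provable L P S"
  using P S assms(3)
proof (induction rule: sequent_induct)
  case (atomic S)
  have "(\<Inter>v. S v) = {}"
    using atomic(3) unfolding refutes_def by blast
  then show ?case by (rule R_provable.ax[OF atomic(1,2)])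
next
  case (compound S c \<phi>s v)
  then obtain D where "D \<in> P c v" "refutes L I (premise D \<phi>s S)"
    by (auto simp: refutes_iff seq_true_intro[OF P])
  then show ?case using compound by (intro R_provable.intro) auto
qed

theorem S_adequate:
  fixes S :: "('v::finite, 'p, 'c) tuple"
  assumes "partial_normal_forms L P" "is_sequent L S"
  shows "S_provable L P S \<longleftrightarrow> valid L S"
  using S_sound S_complete assms unfolding valid_def by blast

theorem R_adequate:
  fixes S :: "('v::finite, 'p, 'c) tuple"
  assumes "partial_normal_forms L P" "is_sequent L S"
  shows "R_provable L P S \<longleftrightarrow> refutable L S"
  using R_sound R_complete assms unfolding refutable_def by blast


section \<open>Minimal entailment\<close>

definition min_le ::
  "('v, 'c) fvlogic \<Rightarrow> 'v set \<Rightarrow> 'p set \<Rightarrow> ('p, 'v) interp \<Rightarrow> ('p, 'v) interp \<Rightarrow> bool" where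
  "min_le L \<I> \<Theta> I J \<longleftrightarrow>
     {p \<in> \<Theta>. val L I (Atom p :: ('p, 'c) form) \<in> \<I>} \<subseteq> {p \<in> \<Theta>. val L J (Atom p :: ('p, 'c) form) \<in> \<I>}"

definition min_less ::
  "('v, 'c) fvlogic \<Rightarrow> 'v set \<Rightarrow> 'p set \<Rightarrow> ('p, 'v) interp \<Rightarrow> ('p, 'v) interp \<Rightarrow> bool" where
  "min_less L \<I> \<Theta> I J \<longleftrightarrow> min_le L \<I> \<Theta> I J \<and> \<not> min_le L \<I> \<Theta> J I"

definition minimal_model ::
  "('v, 'c) fvlogic \<Rightarrow> 'v set \<Rightarrow> 'p set \<Rightarrow> ('p, 'c) form set \<Rightarrow> ('p, 'v) interp \<Rightarrow> bool" where
  "minimal_model L \<I> \<Theta> \<Gamma> I \<longleftrightarrow>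
     models_theory L I \<Gamma> \<and> \<not> (\<exists>J. models_theory L J \<Gamma> \<and> min_less L \<I> \<Theta> J I)"

text \<open>
  The arguments \<open>\<Sigma> \<Gamma> \<Delta> \<Theta>\<close> of the next two predicates form the quadruple
  \<open>\<Sigma>; \<Gamma> \<Rightarrow> \<Delta>; \<Theta>\<close>, whose components may be infinite.
\<close>

definition ME_true ::
  "('v, 'c) fvlogic \<Rightarrow> 'v set \<Rightarrow>
   'p set \<Rightarrow> ('p, 'c) form set \<Rightarrow> ('p, 'c) form set \<Rightarrow> 'p set \<Rightarrow> bool" where
  "ME_true L \<I> \<Sigma> \<Gamma> \<Delta> \<Theta> \<longleftrightarrow>
     (\<forall>I. minimal_model L \<I> (\<Theta> \<union> \<Sigma>) \<Gamma> I \<and>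
          (\<forall>p \<in> \<Sigma>. val L I (Atom p :: ('p, 'c) form) \<in> \<I>) \<longrightarrow>
          (\<exists>\<phi> \<in> \<Delta>. models L I \<phi>))"

inductive ME_provable ::
  "('v, 'c) fvlogic \<Rightarrow> ('v, 'c) pnf \<Rightarrow> 'c \<Rightarrow> 'c \<Rightarrow>
   'p set \<Rightarrow> ('p, 'c) form set \<Rightarrow> ('p, 'c) form set \<Rightarrow> 'p set \<Rightarrow> bool"
  for L P i ib where
  m1: "R_provable L P (two_sided L (\<Gamma> \<union> app1 ib ` \<Theta>) {app1 i q}) \<Longrightarrow> \<Delta> \<subseteq> forms L \<Longrightarrow>
    ME_provable L P i ib ({q} \<union> \<Sigma>) \<Gamma> \<Delta> \<Theta>"
| m2: "S_provable L P (two_sided L (app1 i ` \<Sigma> \<union> \<Gamma>) \<Delta>) \<Longrightarrow>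
    ME_provable L P i ib \<Sigma> \<Gamma> \<Delta> \<Theta>"
| m3: "ME_provable L P i ib ({q} \<union> \<Sigma>) \<Gamma> \<Delta> \<Theta> \<Longrightarrow>
    ME_provable L P i ib \<Sigma> (\<Gamma> \<union> {app1 ib q}) \<Delta> \<Theta> \<Longrightarrow>
    ME_provable L P i ib \<Sigma> \<Gamma> \<Delta> (\<Theta> \<union> {q})"

end

(* For m1, the interpretation J refuting the premise makes q and all of \<Theta> fall outside \<I>, so it
   lies strictly below every model of \<Gamma> that sends {q} \<union> \<Sigma> into \<I>; hence no such model is minimal
   and the conclusion is vacuously true. For m3, split on whether the minimal model sends q into \<I>:
   if it does not, then among the models of the second premise q no longer affects the ordering. *)
theory Submission
  imports Defs
begin

text \<open>Each formula of \<open>\<Gamma>\<close> sits in every undesignated component, so it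
  makes the sequent true exactly when its value is undesignated; dually for
  \<open>\<Delta>\<close>.\<close>

lemma seq_true_two_sided:
  "seq_true L I (two_sided L \<Gamma> \<Delta>) \<longleftrightarrow> \<not> models_theory L I \<Gamma> \<or> (\<exists>\<phi> \<in> \<Delta>. models L I \<phi>)"
  unfolding seq_true_def two_sided_def models_theory_def models_def by (auto split: if_splits) metis+

lemma models_theory_Un:
  "models_theory L I (\<Gamma> \<union> \<Delta>) \<longleftrightarrow> models_theory L I \<Gamma> \<and> models_theory L I \<Delta>"
  unfolding models_theory_def by blast

context
  fixes L :: "('v::finite, 'c::finite) fvlogic" and \<I> :: "'v set" and i ib :: 'c
  assumes logic: "finite_valued_logic L" and ind: "indicators L \<I> i ib"
begin

text \<open>The indicator only takes the values \<open>ttrue L\<close>, which is designated, and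
  \<open>tfalse L\<close>, which is not.\<close>

lemma models_indicator: "models L I (app1 i p) \<longleftrightarrow> I p \<in> \<I>"
  using logic ind unfolding finite_valued_logic_def indicators_def models_def by simp

lemma models_co_indicator: "models L I (app1 ib p) \<longleftrightarrow> I p \<notin> \<I>"
  using logic ind unfolding finite_valued_logic_def indicators_def models_def by simp

lemma m1_sound:
  assumes "refutable L (two_sided L (\<Gamma> \<union> app1 ib ` \<Theta>) {app1 i q})"
  shows "ME_true L \<I> ({q} \<union> \<Sigma>) \<Gamma> \<Delta> \<Theta>"
proof -
  obtain J where J: "models_theory L J \<Gamma>" "\<And>p. p \<in> \<Theta> \<Longrightarrow> J p \<notin> \<I>" "J q \<notin> \<I>"
    using assms
    by (auto simp: refutable_def refutes_iff seq_true_two_sided models_theory_Un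
        models_theory_def[of _ _ "app1 ib ` \<Theta>"] models_indicator models_co_indicator)
  \<comment> \<open>Only constants of \<open>\<Sigma>\<close> can lie in \<I> under
    \<open>J\<close>, and these do so under \<open>I\<close> as well; \<open>q\<close> makes the
    inclusion strict.\<close>
  have "min_less L \<I> (\<Theta> \<union> ({q} \<union> \<Sigma>)) J I" if "\<forall>p \<in> {q} \<union> \<Sigma>. I p \<in> \<I>" for I
    using that J(2,3) unfolding min_less_def min_le_def by auto
  then show ?thesis
    using J(1) unfolding ME_true_def minimal_model_def by auto
qed

text \<open>Validity covers every model of \<open>\<Gamma>\<close> that sends
  \<open>\<Sigma>\<close> into \<I>, hence the minimal ones.\<close>

lemma m2_sound:
  assumes "valid L (two_sided L (app1 i ` \<Sigma> \<union> \<Gamma>) \<Delta>)"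
  shows "ME_true L \<I> \<Sigma> \<Gamma> \<Delta> \<Theta>"
  using assms
  by (auto simp: valid_def seq_true_two_sided models_theory_Un models_indicator
      models_theory_def[of _ _ "app1 i ` \<Sigma>"] ME_true_def minimal_model_def)

lemma m3_sound:
  assumes "ME_true L \<I> ({q} \<union> \<Sigma>) \<Gamma> \<Delta> \<Theta>"
    and "ME_true L \<I> \<Sigma> (\<Gamma> \<union> {app1 ib q}) \<Delta> \<Theta>"
  shows "ME_true L \<I> \<Sigma> \<Gamma> \<Delta> (\<Theta> \<union> {q})"
  unfolding ME_true_def
proof (intro allI impI, elim conjE)
  fix I
  assume min: "minimal_model L \<I> (\<Theta> \<union> {q} \<union> \<Sigma>) \<Gamma> I"
    and "\<forall>p \<in> \<Sigma>. val L I (Atom p :: ('a, 'c) form) \<in> \<I>"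
  then have \<Sigma>: "\<forall>p \<in> \<Sigma>. I p \<in> \<I>" by simp
  have models_extended: "models_theory L J (\<Gamma> \<union> {app1 ib q}) \<longleftrightarrow> models_theory L J \<Gamma> \<and> J q \<notin> \<I>" for J
    by (auto simp: models_theory_def models_co_indicator)
  show "\<exists>\<phi> \<in> \<Delta>. models L I \<phi>"
  proof (cases "I q \<in> \<I>")
    case True
    \<comment> \<open>Moving \<open>q\<close> from \<open>\<Theta>\<close> to
      \<open>\<Sigma>\<close> leaves their union, and so the ordering, unchanged.\<close>
    then show ?thesis
      using assms(1) min \<Sigma> by (simp add: ME_true_def)
  next
    case False
    \<comment> \<open>Since \<open>q\<close> is outside \<I> under both interpretations, it enters
      neither of the compared sets.\<close>
    have "min_less L \<I> (\<Theta> \<union> {q} \<union> \<Sigma>) J I" if "min_less L \<I> (\<Theta> \<union> \<Sigma>) J I" "J q \<notin> \<I>" for J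
      using that False unfolding min_less_def min_le_def by auto
    then have "minimal_model L \<I> (\<Theta> \<union> \<Sigma>) (\<Gamma> \<union> {app1 ib q}) I"
      using min False unfolding minimal_model_def models_extended by blast
    then show ?thesis
      using assms(2) \<Sigma> by (simp add: ME_true_def)
  qed
qed

end

theorem mainTheorem2:
  fixes L :: "('v::finite, 'c::finite) fvlogic"
    and P :: "('v, 'c) pnf"
    and \<I> :: "'v set"
    and i ib :: 'c
    and \<Sigma> \<Theta> :: "'p::{countable, infinite} set"
    and \<Gamma> \<Delta> :: "('p, 'c) form set"
  assumes "finite_valued_logic L"
    and "indicators L \<I> i ib"
    and "partial_normal_forms L P"
    and "ME_provable L P i ib \<Sigma> \<Gamma> \<Delta> \<Theta>"
  shows "ME_true L \<I> \<Sigma> \<Gamma> \<Delta> \<Theta>"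
  using assms(4)
proof (induction rule: ME_provable.induct)
  case (m1 \<Gamma> \<Theta> q \<Delta> \<Sigma>)
  \<comment> \<open>Soundness of the anti-sequent calculus supplies the refuting
    interpretation.\<close>
  then have "refutable L (two_sided L (\<Gamma> \<union> app1 ib ` \<Theta>) {app1 i q})"
    unfolding refutable_def by (intro R_sound[OF assms(3)])
  then show ?case by (rule m1_sound[OF assms(1,2)])
next
  case (m2 \<Sigma> \<Gamma> \<Delta> \<Theta>)
  then show ?case
    using m2_sound[OF assms(1,2)] S_sound[OF assms(3)] unfolding valid_def by blast
next
  case (m3 q \<Sigma> \<Gamma> \<Delta> \<Theta>)
  show ?case by (rule m3_sound[OF assms(1,2) m3.IH])
qed

end
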